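(* Let $[\underline{x}_0,\overline{x}_0]\subset\mathbb{R}^n$ be an interval and let $m\in\mathbb{R}^{1\times n}$ be a row vector. The robust optimization problem $$\tilde m^*=\operatorname*{arg\,min}_{\tilde m\in\mathbb{R}^{1\times n}}\ \big|(\hat m^\oplus-m^\oplus)\underline x-(\hat m^\ominus-m^\ominus)\overline x\big|\qquad\forall\,[\underline x,\overline x]\subseteq[\underline x_0,\overline x_0],\qquad \hat m=m+\tilde m,$$ can be equivalently reformulated as the linear program $$\begin{aligned}&\min_{\xi\in\mathbb{R}^{2n+1},\ p_1,p_2\in\mathbb{R}^{3n}} c^\top\xi\\ &\text{s.t. } \Lambda\xi\le l,\quad p_1^\top d\le0,\quad p_2^\top d\le0,\quad \Gamma^\top p_1=\xi,\quad -\Gamma^\top p_2=\xi,\quad p_1\ge\mathbf{0}_{3n},\quad p_2\ge\mathbf{0}_{3n},\end{aligned}$$ where $$d=\begin{bmatrix}\overline x_0^\top&\underline x_0^\top&\mathbf{0}_n^\top\end{bmatrix}^\top,\quad l=\begin{bmatrix}m^\oplus&m^\ominus&0\end{bmatrix}^\top,\quad c=\begin{bmatrix}\mathbf{0}_{2n}^\top&1\end{bmatrix}^\top,$$ $$\Gamma=\begin{bmatrix}\mathbf{0}_{n\times n} & -I_n & \mathbf{0}_n \\ -I_n & \mathbf{0}_{n\times n} & \mathbf{0}_n \\ {I_n} & I_n & \mathbf{0}_n\end{bmatrix},\qquad \Lambda=\begin{bmatrix}-I_n & \mathbf{0}_{n\times n} & \mathbf{0}_n \\ \mathbf{0}_{n\times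 n} & -I_n & \mathbf{0}_n \\ \mathbf{0}_n^\top & \mathbf{0}_n^\top & -1\end{bmatrix}.$$ Moreover, with $\tilde m^*$ and $\xi^*$ denoting solutions of the robust optimization problem and of the linear program, respectively, $$\tilde m^*=(\xi^* )^\top\begin{bmatrix}I_n&-I_n&\mathbf{0}_n\end{bmatrix}^\top.$$
   Context: Vector inequalities are componentwise. For a real matrix or vector $M$, $M^\oplus=\max(M,0)$ entrywise and $M^\ominus=M^\oplus-M$. $I_n$ is the identity matrix, $\mathbf{0}_{n\times n}$ the zero matrix, $\mathbf{0}_n$ the zero column vector. The robust optimization problem means: minimize $\theta\ge0$ over $(\tilde m,\theta)$ subject to $-\theta\le(\hat m^\oplus-m^\oplus)\underline x-(\hat m^\ominus-m^\ominus)\overline x\le\theta$ for all intervals $[\underline x,\overline x]\subseteq[\underline x_0,\overline x_0]$. The variable $\xi$ of the linear program corresponds to $\xi=[\,\hat m^\oplus-m^\oplus\ \ \hat m^\ominus-m^\ominus\ \ \theta\,]^\top$.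
   Formalization: The middle block of d is taken as the negative of the lower bound, d = [x̄0; −x̲0; 0], since with the printed +x̲0 the claim fails (n=1, m=0, box [−2,−1]: ξ=(1,0,0) is LP-optimal but gives m̃=1, which is not a robust solution). *)

theory Defs
  imports "HOL-Analysis.Analysis"
begin

text \<open>
  Row vectors in \<open>R^(1 x n)\<close> and column vectors in \<open>R^n\<close> are both \<open>real ^ 'n\<close>; a row
  vector times a column vector is the inner product.  Dimensions \<open>2n + 1\<close> and \<open>3n\<close> are the
  index types \<open>'n + 'n + 1\<close> and \<open>'n + 'n + 'n\<close>.
\<close>

definition pos_part :: "real ^ 'n \<Rightarrow> real ^ 'n" where
  "pos_part v = (\<chi> i. max (v $ i) 0)"

definition neg_part :: "real ^ 'n \<Rightarrow> real ^ 'n" where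
  "neg_part v = pos_part v - v"

text \<open>
  Vertical stacking of three blocks.  The entry type is arbitrary, so this stacks column vectors
  as well as matrices (whose entries are rows).
\<close>

definition vstack3 :: "'e ^ 'a \<Rightarrow> 'e ^ 'b \<Rightarrow> 'e ^ 'c \<Rightarrow> 'e ^ ('a + 'b + 'c)" where
  "vstack3 u v w = (\<chi> k. case k of Inl i \<Rightarrow> u $ i | Inr (Inl i) \<Rightarrow> v $ i | Inr (Inr i) \<Rightarrow> w $ i)"

definition hstack3 :: "'e ^ 'a ^ 'r \<Rightarrow> 'e ^ 'b ^ 'r \<Rightarrow> 'e ^ 'c ^ 'r \<Rightarrow> 'e ^ ('a + 'b + 'c) ^ 'r" where
  "hstack3 A B C = (\<chi> r. vstack3 (A $ r) (B $ r) (C $ r))"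


subsection \<open>The robust optimization problem\<close>

definition robust_feasible ::
  "real ^ 'n \<Rightarrow> real ^ 'n \<Rightarrow> real ^ 'n \<Rightarrow> (real ^ 'n) \<times> real \<Rightarrow> bool" where
  "robust_feasible xl0 xu0 m = (\<lambda>(mt, \<theta>). let mh = m + mt in
     \<theta> \<ge> 0 \<and>
     (\<forall>xl xu. xl \<le> xu \<longrightarrow> {xl..xu} \<subseteq> {xl0..xu0} \<longrightarrow>
        - \<theta> \<le> (pos_part mh - pos_part m) \<bullet> xl - (neg_part mh - neg_part m) \<bullet> xu \<and>
        (pos_part mh - pos_part m) \<bullet> xl - (neg_part mh - neg_part m) \<bullet> xu \<le> \<theta>))"

definition robust_solution ::
  "real ^ 'n \<Rightarrow> real ^ 'n \<Rightarrow> real ^ 'n \<Rightarrow> (real ^ 'n) \<times> real \<Rightarrow> bool" where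
  "robust_solution xl0 xu0 m = is_arg_min (\<lambda>(mt, \<theta>). \<theta>) (robust_feasible xl0 xu0 m)"


subsection \<open>The linear program\<close>

text \<open>
  \<open>lp_Gamma\<close> and \<open>lp_d\<close> describe the subintervals of \<open>[xl0, xu0]\<close>: the three blocks of rows
  applied to \<open>(xl, - xu, s)\<close> (any \<open>s\<close>) say \<open>xu \<le> xu0\<close>, \<open>- xl \<le> - xl0\<close> and \<open>xl - xu \<le> 0\<close>.
  The middle block of the right-hand side is therefore \<open>- xl0\<close>.  With \<open>xl0\<close> there instead,
  the program is not equivalent to the robust problem: for \<open>n = 1\<close>, \<open>m = 0\<close>,
  \<open>[xl0, xu0] = [-2, -1]\<close> the vector \<open>\<xi> = (1, 0, 0)\<close> would be optimal (with
  \<open>p1 = (1, 0, 1)\<close>, \<open>p2 = (0, 1, 0)\<close>), although \<open>0\<close> is the only solution of the robust problem.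
\<close>

definition lp_d :: "real ^ 'n \<Rightarrow> real ^ 'n \<Rightarrow> real ^ ('n + 'n + 'n)" where
  "lp_d xl0 xu0 = vstack3 xu0 (- xl0) 0"

definition lp_l :: "real ^ 'n \<Rightarrow> real ^ ('n + 'n + 1)" where
  "lp_l m = vstack3 (pos_part m) (neg_part m) 0"

definition lp_c :: "real ^ ('n::finite + 'n + 1)" where
  "lp_c = vstack3 0 0 (vec 1)"

definition lp_Gamma :: "real ^ ('n::finite + 'n + 1) ^ ('n + 'n + 'n)" where
  "lp_Gamma = vstack3
     (hstack3 0 (- mat 1) 0)
     (hstack3 (- mat 1) 0 0)
     (hstack3 (mat 1) (mat 1) 0)"

definition lp_Lambda :: "real ^ ('n::finite + 'n + 1) ^ ('n + 'n + 1)" where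
  "lp_Lambda = vstack3
     (hstack3 (- mat 1) 0 0)
     (hstack3 0 (- mat 1) 0)
     (hstack3 0 0 (- mat 1))"

definition lp_feasible ::
  "real ^ 'n \<Rightarrow> real ^ 'n \<Rightarrow> real ^ 'n \<Rightarrow>
    (real ^ ('n + 'n + 1)) \<times> (real ^ ('n + 'n + 'n)) \<times> (real ^ ('n + 'n + 'n)) \<Rightarrow> bool" where
  "lp_feasible xl0 xu0 m = (\<lambda>(\<xi>, p1, p2).
     lp_Lambda *v \<xi> \<le> lp_l m \<and>
     p1 \<bullet> lp_d xl0 xu0 \<le> 0 \<and> p2 \<bullet> lp_d xl0 xu0 \<le> 0 \<and>
     transpose lp_Gamma *v p1 = \<xi> \<and> - (transpose lp_Gamma *v p2) = \<xi> \<and>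
     p1 \<ge> 0 \<and> p2 \<ge> 0)"

definition lp_solution ::
  "real ^ 'n \<Rightarrow> real ^ 'n \<Rightarrow> real ^ 'n \<Rightarrow>
    (real ^ ('n + 'n + 1)) \<times> (real ^ ('n + 'n + 'n)) \<times> (real ^ ('n + 'n + 'n)) \<Rightarrow> bool" where
  "lp_solution xl0 xu0 m = is_arg_min (\<lambda>(\<xi>, p1, p2). lp_c \<bullet> \<xi>) (lp_feasible xl0 xu0 m)"


subsection \<open>Passing between the two problems\<close>

definition xi_of :: "real ^ 'n \<Rightarrow> real ^ 'n \<Rightarrow> real \<Rightarrow> real ^ ('n + 'n + 1)" where
  "xi_of m mt \<theta> = (let mh = m + mt in
     vstack3 (pos_part mh - pos_part m) (neg_part mh - neg_part m) (vec \<theta>))"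

definition mt_of :: "real ^ ('n::finite + 'n + 1) \<Rightarrow> real ^ 'n" where
  "mt_of \<xi> = \<xi> v* transpose (hstack3 (mat 1) (- mat 1) 0)"

end

theory Submission
  imports Defs
begin

text \<open>
  The last column of \<open>lp_Gamma\<close> is zero, so \<open>transpose lp_Gamma *v p1 = \<xi>\<close> forces the last
  entry \<open>\<theta>\<close> of \<open>\<xi>\<close> to vanish: every feasible point of the linear program has objective \<open>0\<close>
  and is optimal.  The robust problem has optimal value \<open>0\<close> as well, attained at \<open>mt = 0\<close>.
  Hence both problems are really feasibility problems, and both ask for the same thing, namely
  that a form \<open>a \<bullet> xl - b \<bullet> xu\<close> vanishes on all subintervals \<open>[xl, xu]\<close> of \<open>[xl0, xu0]\<close>.

  For the linear program this is linear programming duality.  The vectors \<open>p1\<close> and \<open>p2\<close> are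
  Farkas certificates for \<open>a \<bullet> xl - b \<bullet> xu \<le> 0\<close> and for the reverse inequality on the polyhedron
  \<open>xu \<le> xu0\<close>, \<open>xl0 \<le> xl\<close>, \<open>xl \<le> xu\<close> (\<open>certificate_imp_le\<close>).  Certificates can be
  written down (\<open>vanishes_imp_certificate\<close>) because the forms in question are known explicitly
  (\<open>vanishes_on_subintervals_iff\<close>): moving one endpoint of one coordinate at a time shows that
  \<open>a\<close> and \<open>b\<close> vanish in every coordinate in which \<open>[xl0, xu0]\<close> has positive length; in the
  remaining coordinates \<open>xl\<close> and \<open>xu\<close> are forced to agree with \<open>xl0\<close>, so only
  \<open>(a - b) \<bullet> xl0 = 0\<close> is left.

  A robust solution \<open>mt\<close> gives \<open>a = mh\<^sup>\<oplus> - m\<^sup>\<oplus>\<close> and \<open>b = mh\<^sup>\<ominus> - m\<^sup>\<ominus>\<close>, with \<open>a - b = mt\<close>.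
  Conversely, for an LP solution the nonnegative vectors \<open>m\<^sup>\<oplus> + a\<close> and \<open>m\<^sup>\<ominus> + b\<close> need not be
  the positive and negative part of \<open>mh = m + a - b\<close>: both may exceed them by a common vector.
  This is harmless.  Where \<open>a\<close> and \<open>b\<close> vanish, so do the true differences of the parts; elsewhere
  only \<open>a - b\<close> matters, and that is the same for both pairs.
\<close>

section \<open>Vectors and matrices made of three blocks\<close>

lemma vstack3_nth [simp]:
  "vstack3 u v w $ Inl i = u $ i"
  "vstack3 u v w $ Inr (Inl j) = v $ j"
  "vstack3 u v w $ Inr (Inr k) = w $ k"
  by (simp_all add: vstack3_def)

lemma all_sum3: "(\<forall>k. P k) \<longleftrightarrow> (\<forall>i. P (Inl i)) \<and> (\<forall>j. P (Inr (Inl j))) \<and> (\<forall>k. P (Inr (Inr k)))"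
  by (metis sum.exhaust)

lemma vstack3_eq_iff: "vstack3 u v w = vstack3 u' v' w' \<longleftrightarrow> u = u' \<and> v = v' \<and> w = w'"
  by (simp add: vec_eq_iff all_sum3)

lemma vstack3_le_iff:
  fixes u :: "'e::ord ^ 'a::finite" and v :: "'e ^ 'b::finite" and w :: "'e ^ 'c::finite"
  shows "vstack3 u v w \<le> vstack3 u' v' w' \<longleftrightarrow> u \<le> u' \<and> v \<le> v' \<and> w \<le> w'"
  by (simp add: less_eq_vec_def all_sum3)

lemma vstack3_zero: "vstack3 0 0 0 = 0"
  by (simp add: vec_eq_iff all_sum3)

lemma vstack3_uminus:
  fixes u :: "'e::group_add ^ 'a" and v :: "'e ^ 'b" and w :: "'e ^ 'c"
  shows "- vstack3 u v w = vstack3 (- u) (- v) (- w)"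
  by (simp add: vec_eq_iff all_sum3)

lemma vstack3_cases:
  obtains u v w where "x = vstack3 u v w"
proof
  show "x = vstack3 (\<chi> i. x $ Inl i) (\<chi> j. x $ Inr (Inl j)) (\<chi> k. x $ Inr (Inr k))"
    by (simp add: vec_eq_iff all_sum3)
qed

lemma sum_UNIV_sum3:
  fixes f :: "'a::finite + 'b::finite + 'c::finite \<Rightarrow> 'r::comm_monoid_add"
  shows "sum f UNIV =
    (\<Sum>i\<in>UNIV. f (Inl i)) + ((\<Sum>j\<in>UNIV. f (Inr (Inl j))) + (\<Sum>k\<in>UNIV. f (Inr (Inr k))))"
  by (simp add: UNIV_Plus_UNIV[symmetric] sum.Plus comp_def del: UNIV_Plus_UNIV)

lemma vstack3_inner:
  fixes u :: "real ^ 'a::finite" and v :: "real ^ 'b::finite" and w :: "real ^ 'c::finite"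
  shows "vstack3 u v w \<bullet> vstack3 u' v' w' = u \<bullet> u' + (v \<bullet> v' + w \<bullet> w')"
  by (simp add: inner_vec_def sum_UNIV_sum3)

lemma vstack3_mult_vec:
  fixes x :: "real ^ 'n::finite"
  shows "vstack3 A B C *v x = vstack3 (A *v x) (B *v x) (C *v x)"
  by (simp add: vec_eq_iff all_sum3 matrix_vector_mult_def)

lemma hstack3_mult_vec:
  fixes u :: "real ^ 'a::finite" and v :: "real ^ 'b::finite" and w :: "real ^ 'c::finite"
  shows "hstack3 A B C *v vstack3 u v w = A *v u + (B *v v + C *v w)"
  by (simp add: vec_eq_iff matrix_vector_mult_def hstack3_def sum_UNIV_sum3)

lemma vec_mult_vstack3:
  fixes u :: "real ^ 'a::finite" and v :: "real ^ 'b::finite" and w :: "real ^ 'c::finite"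
  shows "vstack3 u v w v* vstack3 A B C = u v* A + (v v* B + w v* C)"
  by (simp add: vec_eq_iff vector_matrix_mult_def sum_UNIV_sum3)

lemma vec_mult_hstack3:
  fixes x :: "real ^ 'r::finite"
  shows "x v* hstack3 A B C = vstack3 (x v* A) (x v* B) (x v* C)"
  by (simp add: vec_eq_iff all_sum3 vector_matrix_mult_def hstack3_def)

lemma uminus_matrix_mult:
  fixes A :: "real ^ 'n::finite ^ 'm::finite"
  shows "(- A) *v x = - (A *v x)" and "y v* (- A) = - (y v* A)"
  by (simp_all add: vec_eq_iff matrix_vector_mult_def vector_matrix_mult_def sum_negf)

section \<open>Forms that vanish on all subintervals\<close>

definition vanishes_on_subintervals ::
  "real ^ 'n \<Rightarrow> real ^ 'n \<Rightarrow> real ^ 'n \<Rightarrow> real ^ 'n \<Rightarrow> bool" where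
  "vanishes_on_subintervals xl0 xu0 a b \<longleftrightarrow>
     (\<forall>xl xu. xl0 \<le> xl \<longrightarrow> xl \<le> xu \<longrightarrow> xu \<le> xu0 \<longrightarrow> a \<bullet> xl = b \<bullet> xu)"

text \<open>
  Comparing the degenerate interval at \<open>xl0\<close> with intervals that differ from it or from
  \<open>[xl0, xu0]\<close> in one endpoint of one coordinate isolates that coordinate.  A coordinate of
  positive length cannot contribute at all; a coordinate of length zero contributes a constant.
\<close>

lemma vanishes_on_subintervals_iff:
  fixes xl0 xu0 a b :: "real ^ 'n"
  assumes "xl0 \<le> xu0"
  shows "vanishes_on_subintervals xl0 xu0 a b \<longleftrightarrow>
    (\<forall>i. xl0 $ i = xu0 $ i \<or> a $ i = 0 \<and> b $ i = 0) \<and> (a - b) \<bullet> xl0 = 0" (is "?L \<longleftrightarrow> ?R")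
proof
  assume ?L
  have form: "a \<bullet> xl = b \<bullet> xu" if "xl0 \<le> xl" "xl \<le> xu" "xu \<le> xu0" for xl xu
    using \<open>?L\<close> that by (simp add: vanishes_on_subintervals_def)
  have ends: "a \<bullet> xl0 = b \<bullet> xl0" "a \<bullet> xl0 = b \<bullet> xu0"
    using form assms by blast+
  have "a $ i = 0 \<and> b $ i = 0" if "xl0 $ i \<noteq> xu0 $ i" for i
  proof -
    \<comment> \<open>\<open>y\<close> is \<open>xl0\<close> with its \<open>i\<close>-th coordinate moved to the upper end.\<close>
    define y where "y = xl0 + axis i (xu0 $ i - xl0 $ i)"
    have y: "xl0 \<le> y" "y \<le> xu0"
      using assms by (auto simp: y_def axis_def less_eq_vec_def)
    have "a \<bullet> y = b \<bullet> xu0" "a \<bullet> xl0 = b \<bullet> y"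
      using form y assms by blast+
    moreover have "a \<bullet> y = a \<bullet> xl0 + a $ i * (xu0 $ i - xl0 $ i)"
      and "b \<bullet> y = b \<bullet> xl0 + b $ i * (xu0 $ i - xl0 $ i)"
      by (simp_all add: y_def inner_add_right inner_axis)
    ultimately show ?thesis
      using ends that by auto
  qed
  then show ?R
    using ends by (auto simp: inner_diff_left)
next
  assume R: ?R
  have "a \<bullet> xl = b \<bullet> xu" if "xl0 \<le> xl" "xl \<le> xu" "xu \<le> xu0" for xl xu
  proof -
    have "a $ i * xl $ i = a $ i * xl0 $ i \<and> b $ i * xu $ i = b $ i * xl0 $ i" for i
    proof (cases "xl0 $ i = xu0 $ i")
      case True
      then have "xl $ i = xl0 $ i" "xu $ i = xl0 $ i"
        using that unfolding less_eq_vec_def by (metis order.antisym order.trans)+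
      then show ?thesis by simp
    next
      case False
      then show ?thesis using R by auto
    qed
    then have "a \<bullet> xl = a \<bullet> xl0" "b \<bullet> xu = b \<bullet> xl0"
      unfolding inner_vec_def inner_real_def by (metis (lifting))+
    then show ?thesis using R by (simp add: inner_diff_left)
  qed
  then show ?L by (simp add: vanishes_on_subintervals_def)
qed

lemma vanishes_on_subintervals_uminus:
  "vanishes_on_subintervals xl0 xu0 a b \<Longrightarrow> vanishes_on_subintervals xl0 xu0 (- a) (- b)"
  by (simp add: vanishes_on_subintervals_def)

section \<open>Dual certificates\<close>

text \<open>
  Dual feasibility, with multipliers \<open>p\<close>, \<open>q\<close>, \<open>r\<close> for the constraints \<open>xu \<le> xu0\<close>,
  \<open>- xl \<le> - xl0\<close> and \<open>xl - xu \<le> 0\<close>: they combine to the form \<open>a \<bullet> xl - b \<bullet> xu\<close> on the left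
  and to a nonpositive number on the right.
\<close>

definition certificate ::
  "real ^ 'n \<Rightarrow> real ^ 'n \<Rightarrow> real ^ 'n \<Rightarrow> real ^ 'n \<Rightarrow> real ^ 'n \<Rightarrow> real ^ 'n \<Rightarrow> real ^ 'n \<Rightarrow> bool" where
  "certificate xl0 xu0 a b p q r \<longleftrightarrow>
     p \<bullet> xu0 \<le> q \<bullet> xl0 \<and> r - q = a \<and> r - p = b \<and> 0 \<le> p \<and> 0 \<le> q \<and> 0 \<le> r"

lemma inner_mono_right_vec:
  fixes p x y :: "real ^ 'n"
  assumes "0 \<le> p" "x \<le> y"
  shows "p \<bullet> x \<le> p \<bullet> y"
  using assms by (auto simp: inner_vec_def less_eq_vec_def intro!: sum_mono mult_left_mono)

text \<open>Weak duality.\<close>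

lemma certificate_imp_le:
  fixes xl0 xu0 xl xu p q r :: "real ^ 'n"
  assumes "certificate xl0 xu0 a b p q r"
    and "xl0 \<le> xl" "xl \<le> xu" "xu \<le> xu0"
  shows "a \<bullet> xl \<le> b \<bullet> xu"
proof -
  have cert: "p \<bullet> xu0 \<le> q \<bullet> xl0" "0 \<le> p" "0 \<le> q" "0 \<le> r" and ab: "a = r - q" "b = r - p"
    using assms(1) by (auto simp: certificate_def)
  have "p \<bullet> xu \<le> p \<bullet> xu0" "q \<bullet> xl0 \<le> q \<bullet> xl" "r \<bullet> xl \<le> r \<bullet> xu"
    using cert assms(2-) by (simp_all add: inner_mono_right_vec)
  then show ?thesis
    using cert(1) by (simp add: ab inner_diff_left)
qed

text \<open>
  Once \<open>q\<close> is chosen, \<open>r\<close> and \<open>p\<close> are determined by \<open>a\<close> and \<open>b\<close>.  In coordinates of length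
  zero the choice of \<open>q\<close> does not affect \<open>p \<bullet> xu0 - q \<bullet> xl0\<close>, so it can be taken large enough to
  make all multipliers nonnegative; in the other coordinates \<open>q = 0\<close> will do.
\<close>

lemma vanishes_imp_certificate:
  fixes xl0 xu0 a b :: "real ^ 'n"
  assumes "xl0 \<le> xu0" and "vanishes_on_subintervals xl0 xu0 a b"
  shows "\<exists>p q r. certificate xl0 xu0 a b p q r"
proof -
  define t :: "real ^ 'n" where "t = (\<chi> i. \<bar>a $ i\<bar> + \<bar>b $ i\<bar>)"
  have R: "\<forall>i. xl0 $ i = xu0 $ i \<or> a $ i = 0 \<and> b $ i = 0" "(a - b) \<bullet> xl0 = 0"
    using assms vanishes_on_subintervals_iff by blast+
  have "(a - b + t) \<bullet> xu0 = (a - b + t) \<bullet> xl0"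
    unfolding inner_vec_def
  proof (rule sum.cong[OF refl])
    show "(a - b + t) $ i \<bullet> xu0 $ i = (a - b + t) $ i \<bullet> xl0 $ i" for i
      using R(1)[rule_format, of i] by (auto simp: t_def)
  qed
  then have "(a - b + t) \<bullet> xu0 \<le> t \<bullet> xl0"
    using R(2) by (simp add: inner_add_left)
  moreover have "0 \<le> t" "0 \<le> a + t" "0 \<le> a - b + t"
    by (auto simp: less_eq_vec_def t_def)
  ultimately have "certificate xl0 xu0 a b (a - b + t) t (a + t)"
    by (simp add: certificate_def)
  then show ?thesis by blast
qed

section \<open>The linear program\<close>

lemma mt_of_vstack3: "mt_of (vstack3 a b c) = a - b"
  by (simp add: mt_of_def vector_transpose_matrix hstack3_mult_vec uminus_matrix_mult)

lemma lp_c_inner: "lp_c \<bullet> vstack3 a b c = c $ 1"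
  by (simp add: lp_c_def vstack3_inner) (simp add: inner_vec_def)

text \<open>The zero in the last block is why the linear program can only have the value \<open>0\<close>.\<close>

lemma transpose_lp_Gamma_mult:
  "transpose lp_Gamma *v vstack3 p q r = vstack3 (r - q) (r - p) (0 :: real ^ 1)"
  by (simp add: lp_Gamma_def vec_mult_vstack3 vec_mult_hstack3 uminus_matrix_mult
      vec_eq_iff all_sum3)

lemma lp_feasible_vstack3_iff:
  "lp_feasible xl0 xu0 m (vstack3 a b c, vstack3 p1 q1 r1, vstack3 p2 q2 r2) \<longleftrightarrow>
     - pos_part m \<le> a \<and> - neg_part m \<le> b \<and> c = 0 \<and>
     certificate xl0 xu0 a b p1 q1 r1 \<and> certificate xl0 xu0 (- a) (- b) p2 q2 r2"
proof -
  have le: "- a \<le> pos_part m \<longleftrightarrow> - pos_part m \<le> a" "- b \<le> neg_part m \<longleftrightarrow> - neg_part m \<le> b"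
    by (auto simp: less_eq_vec_def minus_le_iff)
  have eq: "- (r2 - q2) = a \<longleftrightarrow> r2 - q2 = - a" "- (r2 - p2) = b \<longleftrightarrow> r2 - p2 = - b"
    by (metis minus_minus)+
  show ?thesis
    by (auto simp: lp_feasible_def certificate_def lp_Lambda_def lp_l_def lp_d_def
        vstack3_mult_vec hstack3_mult_vec uminus_matrix_mult vstack3_le_iff vstack3_inner
        vstack3_eq_iff transpose_lp_Gamma_mult vstack3_uminus le eq vstack3_zero[symmetric]
        simp del: transpose_matrix_vector minus_diff_eq)
qed

text \<open>
  Eliminating the dual variables: \<open>p1\<close> and \<open>p2\<close> together say exactly that the form given by
  \<open>\<xi>\<close> is both nonpositive and nonnegative on all subintervals.
\<close>

lemma lp_feasible_ex_iff:
  fixes xl0 xu0 m :: "real ^ 'n"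
  assumes "xl0 \<le> xu0"
  shows "(\<exists>p1 p2. lp_feasible xl0 xu0 m (vstack3 a b c, p1, p2)) \<longleftrightarrow>
     - pos_part m \<le> a \<and> - neg_part m \<le> b \<and> c = 0 \<and> vanishes_on_subintervals xl0 xu0 a b"
    (is "?L \<longleftrightarrow> ?R")
proof
  assume ?L
  then obtain P1 P2 where "lp_feasible xl0 xu0 m (vstack3 a b c, P1, P2)"
    by blast
  moreover obtain p1 q1 r1 where "P1 = vstack3 p1 q1 r1"
    by (rule vstack3_cases)
  moreover obtain p2 q2 r2 where "P2 = vstack3 p2 q2 r2"
    by (rule vstack3_cases)
  ultimately have *: "- pos_part m \<le> a" "- neg_part m \<le> b" "c = 0"
    and cert: "certificate xl0 xu0 a b p1 q1 r1" "certificate xl0 xu0 (- a) (- b) p2 q2 r2"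
    by (simp_all add: lp_feasible_vstack3_iff)
  have "a \<bullet> xl = b \<bullet> xu" if "xl0 \<le> xl" "xl \<le> xu" "xu \<le> xu0" for xl xu
    using certificate_imp_le[OF cert(1) that] certificate_imp_le[OF cert(2) that] by simp
  then show ?R
    using * by (simp add: vanishes_on_subintervals_def)
next
  assume ?R
  then obtain p1 q1 r1 p2 q2 r2 where
    "certificate xl0 xu0 a b p1 q1 r1" "certificate xl0 xu0 (- a) (- b) p2 q2 r2"
    using vanishes_imp_certificate[OF assms] vanishes_on_subintervals_uminus by metis
  then have "lp_feasible xl0 xu0 m (vstack3 a b c, vstack3 p1 q1 r1, vstack3 p2 q2 r2)"
    using \<open>?R\<close> by (simp add: lp_feasible_vstack3_iff)
  then show ?L by blast
qed

lemma lp_feasible_objective: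
  assumes "lp_feasible xl0 xu0 m (\<xi>, p1, p2)"
  shows "lp_c \<bullet> \<xi> = 0"
proof -
  obtain p q r where "p1 = vstack3 p q r"
    by (rule vstack3_cases)
  then have "\<xi> = vstack3 (r - q) (r - p) 0"
    using assms by (simp add: lp_feasible_def transpose_lp_Gamma_mult del: transpose_matrix_vector)
  then show ?thesis by (simp add: lp_c_inner)
qed

lemma lp_solution_iff_feasible:
  "lp_solution xl0 xu0 m (\<xi>, p1, p2) \<longleftrightarrow> lp_feasible xl0 xu0 m (\<xi>, p1, p2)"
  by (auto simp: lp_solution_def is_arg_min_def lp_feasible_objective)

section \<open>The robust problem\<close>

lemma pos_part_nonneg: "0 \<le> pos_part v"
  by (simp add: pos_part_def less_eq_vec_def)

lemma neg_part_nonneg: "0 \<le> neg_part v"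
  by (simp add: neg_part_def pos_part_def less_eq_vec_def)

lemma robust_feasible_zero_iff:
  fixes xl0 xu0 m mt :: "real ^ 'n"
  shows "robust_feasible xl0 xu0 m (mt, 0) \<longleftrightarrow>
     vanishes_on_subintervals xl0 xu0 (pos_part (m + mt) - pos_part m) (neg_part (m + mt) - neg_part m)"
proof -
  have "xl \<le> xu \<Longrightarrow> {xl..xu} \<subseteq> {xl0..xu0} \<longleftrightarrow> xl0 \<le> xl \<and> xu \<le> xu0" for xl xu :: "real ^ 'n"
    by (meson atLeastatMost_subset_iff)
  then show ?thesis
    unfolding robust_feasible_def vanishes_on_subintervals_def Let_def
    by (auto simp: order.antisym)
qed

text \<open>
  The perturbation \<open>mt = 0\<close> attains the smallest admissible bound \<open>\<theta> = 0\<close>, so the solutions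
  are exactly the feasible points with \<open>\<theta> = 0\<close>.
\<close>

lemma robust_solution_iff:
  "robust_solution xl0 xu0 m (mt, \<theta>) \<longleftrightarrow> \<theta> = 0 \<and>
     vanishes_on_subintervals xl0 xu0 (pos_part (m + mt) - pos_part m) (neg_part (m + mt) - neg_part m)"
proof -
  have zero: "robust_feasible xl0 xu0 m (0, 0)"
    by (simp add: robust_feasible_zero_iff vanishes_on_subintervals_def)
  have nonneg: "robust_feasible xl0 xu0 m (mt', \<theta>') \<Longrightarrow> 0 \<le> \<theta>'" for mt' \<theta>'
    by (simp add: robust_feasible_def Let_def)
  have "robust_solution xl0 xu0 m (mt, \<theta>) \<longleftrightarrow> \<theta> = 0 \<and> robust_feasible xl0 xu0 m (mt, 0)"
    using zero nonneg by (fastforce simp: robust_solution_def is_arg_min_def not_less)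
  then show ?thesis
    by (simp add: robust_feasible_zero_iff)
qed

section \<open>Equivalence of the two problems\<close>

text \<open>
  Two pairs with the same difference give forms that agree where \<open>xl0\<close> and \<open>xu0\<close> coincide.
  Elsewhere \<open>a\<close> and \<open>b\<close> vanish, hence \<open>m\<close> and \<open>m + (a - b)\<close> agree and so do their parts.
\<close>

lemma vanishes_imp_parts_vanish:
  fixes xl0 xu0 m a b :: "real ^ 'n"
  assumes "xl0 \<le> xu0" and "vanishes_on_subintervals xl0 xu0 a b"
  shows "vanishes_on_subintervals xl0 xu0
    (pos_part (m + (a - b)) - pos_part m) (neg_part (m + (a - b)) - neg_part m)"
    (is "vanishes_on_subintervals _ _ ?a ?b")
proof -
  have "?a - ?b = a - b"
    by (simp add: neg_part_def)
  moreover have "?a $ i = 0 \<and> ?b $ i = 0" if "a $ i = 0 \<and> b $ i = 0" for i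
    using that by (simp add: neg_part_def pos_part_def)
  moreover have "\<forall>i. xl0 $ i = xu0 $ i \<or> a $ i = 0 \<and> b $ i = 0" "(a - b) \<bullet> xl0 = 0"
    using assms vanishes_on_subintervals_iff by blast+
  ultimately show ?thesis
    unfolding vanishes_on_subintervals_iff[OF assms(1)] by metis
qed

lemma robust_imp_lp_solution:
  fixes xl0 xu0 m mt :: "real ^ 'n"
  assumes "xl0 \<le> xu0" and "robust_solution xl0 xu0 m (mt, \<theta>)"
  shows "\<exists>p1 p2. lp_solution xl0 xu0 m (xi_of m mt \<theta>, p1, p2)"
proof -
  have "- pos_part m \<le> pos_part (m + mt) - pos_part m"
    and "- neg_part m \<le> neg_part (m + mt) - neg_part m"
    using pos_part_nonneg[of "m + mt"] neg_part_nonneg[of "m + mt"]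
    by (simp_all add: less_eq_vec_def)
  moreover have "vec \<theta> = (0 :: real ^ 1)"
    using assms(2) by (simp add: robust_solution_iff)
  ultimately show ?thesis
    using assms(2)
    by (simp add: lp_solution_iff_feasible xi_of_def Let_def lp_feasible_ex_iff[OF assms(1)]
        robust_solution_iff)
qed

lemma lp_imp_robust_solution:
  fixes xl0 xu0 m :: "real ^ 'n"
  assumes "xl0 \<le> xu0" and "lp_solution xl0 xu0 m (\<xi>, p1, p2)"
  shows "robust_solution xl0 xu0 m (mt_of \<xi>, lp_c \<bullet> \<xi>)"
proof -
  obtain a b c where \<xi>: "\<xi> = vstack3 a b c"
    by (rule vstack3_cases)
  have feas: "lp_feasible xl0 xu0 m (\<xi>, p1, p2)"
    using assms(2) by (simp add: lp_solution_iff_feasible)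
  then have "vanishes_on_subintervals xl0 xu0 a b"
    using lp_feasible_ex_iff[OF assms(1)] \<xi> by blast
  then show ?thesis
    using vanishes_imp_parts_vanish[OF assms(1)] lp_feasible_objective[OF feas]
    by (simp add: robust_solution_iff \<xi> mt_of_vstack3)
qed

theorem lemma1:
  fixes xl0 xu0 m :: "real ^ 'n"
  assumes "xl0 \<le> xu0"
  shows
    "(\<exists>mt \<theta>. robust_solution xl0 xu0 m (mt, \<theta>)) \<and>
     (\<exists>\<xi> p1 p2. lp_solution xl0 xu0 m (\<xi>, p1, p2)) \<and>
     (\<forall>mt \<theta>. robust_solution xl0 xu0 m (mt, \<theta>) \<longrightarrow>
        (\<exists>p1 p2. lp_solution xl0 xu0 m (xi_of m mt \<theta>, p1, p2)) \<and>
        lp_c \<bullet> xi_of m mt \<theta> = \<theta> \<and> mt = mt_of (xi_of m mt \<theta>)) \<and>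
     (\<forall>\<xi> p1 p2. lp_solution xl0 xu0 m (\<xi>, p1, p2) \<longrightarrow>
        robust_solution xl0 xu0 m (mt_of \<xi>, lp_c \<bullet> \<xi>))"
proof -
  have robust: "robust_solution xl0 xu0 m (0, 0)"
    by (simp add: robust_solution_iff vanishes_on_subintervals_def)
  moreover have "lp_c \<bullet> xi_of m mt \<theta> = \<theta> \<and> mt = mt_of (xi_of m mt \<theta>)" for mt \<theta>
    by (simp add: xi_of_def Let_def lp_c_inner mt_of_vstack3 neg_part_def)
  ultimately show ?thesis
    using robust_imp_lp_solution[OF assms] lp_imp_robust_solution[OF assms] by blast
qed

end
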